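(* All the rational cubics in $\mathbb{C}P^3$ which pass through the points $(0:0:0:1)$, $(1:1:1:1)$, $(-1:1:-1:1)$ and are tangent to the contact form $\omega_1=3y\,dx-3x\,dy+w\,dz-z\,dw$ are of the form $$l(t,\mu)=\bigl(t,\;t^2+\mu(t-t^3),\;t^3,\;1-3\mu(t-t^3)\bigr),$$ where $\mu\in\mathbb{C}$ is a constant and $t$ is the parameter on the curve.
   Context: Let $(x:y:z:w)$ be homogeneous coordinates on $\mathbb{C}P^3$. A rational cubic is an irreducible rational curve of degree $3$, i.e. the image of a map $\mathbb{C}P^1\to\mathbb{C}P^3$ given by four polynomials of degree at most $3$ in $t$. A curve is tangent to (Legendrian with respect to) $\omega_1$ if for a parametrization $t\mapsto(x(t),y(t),z(t),w(t))$ one has identically $3y\,x'-3x\,y'+w\,z'-z\,w'=0$. The parametrization of a curve is understood up to reparametrization. *)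

theory Defs
  imports "HOL-Analysis.Analysis" "HOL-Computational_Algebra.Polynomial"
begin

definition proportional :: "complex^'n \<Rightarrow> complex^'n \<Rightarrow> bool" where
  "proportional u v \<longleftrightarrow> u \<noteq> 0 \<and> v \<noteq> 0 \<and> (\<exists>c. v = c *s u)"

quotient_type (overloaded) 'n proj = "complex^'n::finite" / partial: proportional
proof (rule part_equivpI)
  show "\<exists>x::complex^'n. proportional x x"
    by (rule exI[of _ "1"]) (auto simp: proportional_def vec_eq_iff intro!: exI[of _ "1"])
  show "symp (proportional :: complex^'n \<Rightarrow> _)"
  proof (rule sympI)
    fix u v :: "complex^'n" assume "proportional u v"
    then obtain c where c: "u \<noteq> 0" "v \<noteq> 0" "v = c *s u"
      by (auto simp: proportional_def)
    then have "c \<noteq> 0" by auto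
    then have "u = inverse c *s v" using c by (simp add: vec_eq_iff)
    then show "proportional v u" using c unfolding proportional_def by blast
  qed
  show "transp (proportional :: complex^'n \<Rightarrow> _)"
    by (rule transpI) (auto simp: proportional_def)
qed

text \<open>The class of \<open>v \<noteq> 0\<close> is \<open>abs_proj v\<close>; \<open>rep_proj q\<close> is
  some choice of (automatically nonzero) homogeneous coordinates of \<open>q\<close>.\<close>

type_synonym CP1 = "2 proj"
type_synonym CP3 = "4 proj"

definition hpoint :: "complex \<Rightarrow> complex \<Rightarrow> complex \<Rightarrow> complex \<Rightarrow> CP3" where
  "hpoint x y z w = abs_proj (vector [x, y, z, w])"

text \<open>Four polynomials of degree at most 3 in the affine parameter \<open>t\<close>, homogenized to
  cubic forms on \<open>\<complex>\<^sup>2\<close>: \<open>t\<close> corresponds to the point \<open>(t : 1)\<close> of the projective line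
  and \<open>t = \<infinity>\<close> to \<open>(1 : 0)\<close>.\<close>

definition homogenize3 :: "complex poly ^ 4 \<Rightarrow> complex ^ 2 \<Rightarrow> complex ^ 4" where
  "homogenize3 p v = (\<chi> i. \<Sum>k\<le>3. coeff (p $ i) k * (v $ 1) ^ k * (v $ 2) ^ (3 - k))"

definition curve_map :: "complex poly ^ 4 \<Rightarrow> CP1 \<Rightarrow> CP3" where
  "curve_map p q = abs_proj (homogenize3 p (rep_proj q))"

text \<open>The second condition says that the four cubic forms have no common zero on the projective
  line, so that they define a map everywhere. It excludes no parametrization of a curve of
  degree 3: cancelling a common factor would leave forms of degree at most 2.\<close>

definition cubic_parametrization :: "complex poly ^ 4 \<Rightarrow> CP3 set \<Rightarrow> bool" where
  "cubic_parametrization p C \<longleftrightarrow>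
     (\<forall>i. degree (p $ i) \<le> 3) \<and>
     (\<forall>v. v \<noteq> 0 \<longrightarrow> homogenize3 p v \<noteq> 0) \<and>
     C = range (curve_map p)"

definition plane :: "complex ^ 4 \<Rightarrow> CP3 set" where
  "plane h = {q. (\<Sum>i\<in>UNIV. h $ i * rep_proj q $ i) = 0}"

text \<open>The degree of a projective curve is its number of intersection points with a generic plane.
  Genericity is expressed by an open dense set of coefficient vectors; since
  two such sets always meet, the degree is unique.\<close>

definition has_degree :: "CP3 set \<Rightarrow> nat \<Rightarrow> bool" where
  "has_degree C d \<longleftrightarrow>
     (\<exists>U. open U \<and> closure U = UNIV \<and>
        (\<forall>h\<in>U. finite (C \<inter> plane h) \<and> card (C \<inter> plane h) = d))"

text \<open>Irreducibility and rationality need no separate clause: they hold for every nonconstant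
  image of the projective line. The degree condition excludes lines and conics, which are also
  images of polynomial maps of degree at most 3.\<close>

definition rational_cubic :: "CP3 set \<Rightarrow> bool" where
  "rational_cubic C \<longleftrightarrow> (\<exists>p. cubic_parametrization p C) \<and> has_degree C 3"

text \<open>\<open>\<omega>\<^sub>1 = 3y dx - 3x dy + w dz - z dw\<close> at the point \<open>u = (x, y, z, w)\<close>, evaluated on the
  vector \<open>d = (dx, dy, dz, dw)\<close>. It is used below with polynomial coordinates.\<close>

definition omega1 :: "'a::comm_ring_1 ^ 4 \<Rightarrow> 'a ^ 4 \<Rightarrow> 'a" where
  "omega1 u d = 3 * u$2 * d$1 - 3 * u$1 * d$2 + u$4 * d$3 - u$3 * d$4"

definition tangent_omega1 :: "CP3 set \<Rightarrow> bool" where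
  "tangent_omega1 C \<longleftrightarrow>
     (\<exists>p. cubic_parametrization p C \<and> omega1 p (\<chi> i. pderiv (p $ i)) = 0)"

text \<open>\<open>l(t, \<mu>) = (t, t\<^sup>2 + \<mu>(t - t\<^sup>3), t\<^sup>3, 1 - 3\<mu>(t - t\<^sup>3))\<close>, with coefficients listed in order of
  increasing degree.\<close>

definition l_family :: "complex \<Rightarrow> complex poly ^ 4" where
  "l_family \<mu> = vector
     [[:0, 1:],
      [:0, \<mu>, 1, - \<mu>:],
      [:0, 0, 0, 1:],
      [:1, - 3 * \<mu>, 0, 3 * \<mu>:]]"

lemma vector_4:
  "(vector [x, y, z, w] :: ('a::zero)^4) $ 1 = x"
  "(vector [x, y, z, w] :: 'a^4) $ 2 = y"
  "(vector [x, y, z, w] :: 'a^4) $ 3 = z"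
  "(vector [x, y, z, w] :: 'a^4) $ 4 = w"
  unfolding vector_def by simp_all

lemma poly_l_family:
  "poly (l_family \<mu> $ 1) t = t"
  "poly (l_family \<mu> $ 2) t = t^2 + \<mu> * (t - t^3)"
  "poly (l_family \<mu> $ 3) t = t^3"
  "poly (l_family \<mu> $ 4) t = 1 - 3 * \<mu> * (t - t^3)"
  by (simp_all add: l_family_def vector_4 algebra_simps power2_eq_square power3_eq_cube)

lemma rep_proj_nonzero: "rep_proj q \<noteq> 0"
  using Quotient3_rep_reflp[OF Quotient3_proj, of q] by (simp add: proportional_def)

lemma curve_map_abs_proj:
  assumes "\<And>v. v \<noteq> 0 \<Longrightarrow> homogenize3 p v \<noteq> 0" and "v \<noteq> 0"
  shows "curve_map p (abs_proj v) = abs_proj (homogenize3 p v)"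
proof -
  have hom: "homogenize3 p (c *s u) = c^3 *s homogenize3 p u" for c u
  proof -
    have "coeff (p $ i) k * (c * u$1)^k * (c * u$2)^(3 - k)
        = c^3 * (coeff (p $ i) k * (u$1)^k * (u$2)^(3 - k))" if "k \<le> 3" for i k
    proof -
      have "c^3 = c^k * c^(3 - k)" using that by (simp flip: power_add)
      then show ?thesis by (simp add: power_mult_distrib)
    qed
    then show ?thesis
      unfolding homogenize3_def vec_eq_iff
      by (auto simp: sum_distrib_left simp del: power_mult_distrib mult_cancel_left intro!: sum.cong)
  qed
  have "proportional v v" using assms(2) by (auto simp: proportional_def intro!: exI[of _ 1])
  then have "proportional (rep_proj (abs_proj v)) v"
    by (rule Quotient3_rep_abs[OF Quotient3_proj])
  then have "proportional (homogenize3 p (rep_proj (abs_proj v))) (homogenize3 p v)"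
    using assms unfolding proportional_def by (metis hom)
  then show ?thesis
    unfolding curve_map_def by (rule Quotient3_rel_abs[OF Quotient3_proj])
qed

end

theory Submission
  imports Defs
begin

text \<open>
  Tangency of \<open>(x, y, z, w)\<close> to \<open>\<omega>\<^sub>1\<close> says \<open>3 W(y, x) + W(w, z) = 0\<close> with the Wronskians
  \<open>W(f, g) = f g' - g f'\<close>.
  The Wronskian of two binary cubic forms is a binary quartic which a linear substitution
  of the variables only multiplies by its determinant (\<open>wronskian_cubic_form\<close>). So tangency
  survives every Moebius change of the parameter, and as the three given points are distinct,
  some such change makes the curve pass through them at \<open>t = 0, 1, -1\<close>
  (\<open>frame_through_three_lines\<close>).

  For a parametrization normalized in this way, the condition at \<open>t = 0\<close> removes the constant
  terms of \<open>x, y, z\<close>, and the two lowest coefficients of the tangency condition then leave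
  \<open>z = c t\<^sup>3\<close>. Evaluation at \<open>t = 1, -1\<close> identifies \<open>c\<close> as the common scaling factor there and
  fixes the even and odd parts of \<open>x, y, w\<close> up to four unknowns; the three remaining
  tangency coefficients tie them together, so that one unknown \<open>\<mu>\<close> survives
  (\<open>normalized_tangent_cubic\<close>). The curve is thus \<open>c l(t, \<mu>)\<close>, which is projectively the
  curve \<open>l(t, \<mu>)\<close>.
\<close>

section \<open>Projective points and homogeneous coordinates\<close>

lemma abs_proj_rep_proj: "abs_proj (rep_proj q) = q"
  by (rule Quotient3_abs_rep[OF Quotient3_proj])

lemma abs_proj_eqD:
  assumes "u \<noteq> 0" "v \<noteq> 0" "abs_proj u = abs_proj v"
  shows "proportional u v"
proof -
  have "proportional w w" if "w \<noteq> 0" for w :: "complex^'n"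
    using that by (auto simp: proportional_def intro!: exI[of _ 1])
  then show ?thesis
    using assms Quotient3_rel[OF Quotient3_proj, of u v] by blast
qed

lemma abs_proj_scale:
  assumes "v \<noteq> 0" "c \<noteq> 0"
  shows "abs_proj (c *s v) = abs_proj v"
proof -
  have "proportional v (c *s v)"
    using assms by (auto simp: proportional_def vec_eq_iff)
  then show ?thesis
    using Quotient3_rel_abs[OF Quotient3_proj] by metis
qed

lemma homogenize3_nth:
  "homogenize3 p v $ i =
     coeff (p $ i) 0 * (v $ 2)^3 + coeff (p $ i) 1 * v $ 1 * (v $ 2)^2
     + coeff (p $ i) 2 * (v $ 1)^2 * v $ 2 + coeff (p $ i) 3 * (v $ 1)^3"
  by (simp add: homogenize3_def eval_nat_numeral)

lemma homogenize3_scale: "homogenize3 p (c *s v) = c^3 *s homogenize3 p v"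
  by (simp add: vec_eq_iff homogenize3_nth algebra_simps eval_nat_numeral)

lemma homogenize3_smult: "homogenize3 (\<chi> i. smult c (p $ i)) v = c *s homogenize3 p v"
  by (simp add: vec_eq_iff homogenize3_nth algebra_simps)

lemma cubic_parametrization_hits:
  assumes "cubic_parametrization p C" "abs_proj a \<in> C" "a \<noteq> 0"
  obtains v c where "v \<noteq> 0" "c \<noteq> 0" "homogenize3 p v = c *s a"
proof -
  from assms obtain q where q: "abs_proj a = abs_proj (homogenize3 p (rep_proj q))"
    and nz: "homogenize3 p (rep_proj q) \<noteq> 0"
    by (auto simp: cubic_parametrization_def curve_map_def rep_proj_nonzero)
  from abs_proj_eqD[OF assms(3) nz q] obtain c where "homogenize3 p (rep_proj q) = c *s a"
    by (auto simp: proportional_def)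
  with nz have "c \<noteq> 0" by auto
  with that[of "rep_proj q" c] rep_proj_nonzero[of q] \<open>homogenize3 p (rep_proj q) = c *s a\<close>
  show thesis by blast
qed

section \<open>Linear change of the parameter\<close>

definition det2 :: "'a::comm_ring_1 ^ 2 \<Rightarrow> 'a ^ 2 \<Rightarrow> 'a" where
  "det2 u v = u $ 1 * v $ 2 - u $ 2 * v $ 1"

lemma det2_eq_0D:
  fixes u v :: "'a::field ^ 2"
  assumes "det2 u v = 0" "u \<noteq> 0"
  obtains c where "v = c *s u"
proof (cases "u $ 1 = 0")
  case True
  with assms have "u $ 2 \<noteq> 0" "v $ 1 = 0"
    by (auto simp: vec_eq_iff forall_2 det2_def)
  with True have "v = (v $ 2 / u $ 2) *s u" by (simp add: vec_eq_iff forall_2)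
  then show thesis by (rule that)
next
  case False
  with assms(1) have "v = (v $ 1 / u $ 1) *s u"
    by (simp add: vec_eq_iff forall_2 det2_def field_simps)
  then show thesis by (rule that)
qed

text \<open>This is the existence of a projectivity of the line with prescribed values at three points:
  \<open>m\<close>, \<open>u + m\<close>, \<open>m - u\<close> are the images of the parameters \<open>0, 1, -1\<close>. The scalars are
  dictated by \<open>det2 b c *s a + det2 c a *s b + det2 a b *s c = 0\<close>, because \<open>2 *s m\<close> has to be
  the sum of the other two vectors.\<close>

lemma frame_through_three_lines:
  fixes a b c :: "'a::field_char_0 ^ 2"
  assumes "det2 b c \<noteq> 0" "det2 c a \<noteq> 0" "det2 a b \<noteq> 0"
  obtains u m r s k where "det2 u m \<noteq> 0" "r \<noteq> 0" "s \<noteq> 0" "k \<noteq> 0"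
    "m = r *s a" "u + m = s *s b" "m - u = k *s c"
proof -
  define m where "m = (- det2 b c / 2) *s a"
  define u where "u = (1/2) *s (det2 c a *s b - det2 a b *s c)"
  have "det2 u m = det2 c a * det2 a b * det2 b c / 2"
    by (simp add: u_def m_def det2_def field_simps)
  then have det: "det2 u m \<noteq> 0" using assms by auto
  have um: "u + m = det2 c a *s b" "m - u = det2 a b *s c"
    by (simp_all add: u_def m_def vec_eq_iff forall_2 det2_def field_simps)
  show thesis
    using assms by (intro that[OF det _ _ _ m_def um]) auto
qed

text \<open>The homogenization of \<open>p\<close> precomposed with the linear map that sends \<open>(1, 0)\<close> to \<open>u\<close> and
  \<open>(0, 1)\<close> to \<open>m\<close>, and dehomogenized again.\<close>

definition reparametrize :: "complex^2 \<Rightarrow> complex^2 \<Rightarrow> complex poly ^ 4 \<Rightarrow> complex poly ^ 4" where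
  "reparametrize u m p =
     (\<chi> i. smult (coeff (p $ i) 0) ([:m $ 2, u $ 2:]^3)
         + smult (coeff (p $ i) 1) ([:m $ 1, u $ 1:] * [:m $ 2, u $ 2:]^2)
         + smult (coeff (p $ i) 2) ([:m $ 1, u $ 1:]^2 * [:m $ 2, u $ 2:])
         + smult (coeff (p $ i) 3) ([:m $ 1, u $ 1:]^3))"

lemma degree_reparametrize: "degree (reparametrize u m p $ i) \<le> 3"
  unfolding reparametrize_def
  by (simp add: eval_nat_numeral degree_pCons_eq_if)

lemma homogenize3_reparametrize:
  "homogenize3 (reparametrize u m p) v = homogenize3 p (v $ 1 *s u + v $ 2 *s m)"
  by (simp add: vec_eq_iff homogenize3_nth reparametrize_def eval_nat_numeral algebra_simps)

text \<open>Here \<open>A'\<close> and \<open>B'\<close> stand for the derivatives of \<open>A\<close> and \<open>B\<close>, and \<open>F'\<close> for the resulting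
  derivative of the cubic form \<open>F\<close>. The bilinear expressions on the right are the coefficients
  of the Wronskian of two cubic polynomials, so a substitution of linear polynomials \<open>A\<close>, \<open>B\<close>
  turns the Wronskian into the same quartic form, times the constant \<open>B A' - A B'\<close>.\<close>

lemma wronskian_cubic_form:
  fixes A B A' B' :: "'a::comm_ring_1"
  defines "F \<equiv> \<lambda>a b c d. a * B^3 + b * (A * B^2) + c * (A^2 * B) + d * A^3"
    and "F' \<equiv> \<lambda>a b c d. a * (3 * B^2 * B') + b * (A' * B^2 + A * (2 * B * B'))
                  + c * (2 * A * A' * B + A^2 * B') + d * (3 * A^2 * A')"
  shows "F a b c d * F' e f g h - F e f g h * F' a b c d =
    (B * A' - A * B') *
      ((a*f - b*e) * B^4 + 2 * (a*g - c*e) * (A * B^3)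
       + (3 * (a*h - d*e) + (b*g - c*f)) * (A^2 * B^2)
       + 2 * (b*h - d*f) * (A^3 * B) + (c*h - d*g) * A^4)"
  unfolding F_def F'_def by (simp add: algebra_simps eval_nat_numeral)

lemma cubic_poly_eq:
  fixes p :: "'a::zero poly"
  assumes "degree p \<le> 3"
  shows "p = [:coeff p 0, coeff p 1, coeff p 2, coeff p 3:]"
proof (rule poly_eqI)
  fix n
  show "coeff p n = coeff [:coeff p 0, coeff p 1, coeff p 2, coeff p 3:] n"
  proof (cases "n \<le> 3")
    case True
    then have "n = 0 \<or> n = 1 \<or> n = 2 \<or> n = 3" by auto
    then show ?thesis by (auto simp: eval_nat_numeral)
  next
    case False
    then have "coeff p n = 0" using assms by (simp add: coeff_eq_0)
    moreover have "degree [:coeff p 0, coeff p 1, coeff p 2, coeff p 3:] \<le> 3"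
      by (simp add: degree_pCons_eq_if)
    ultimately show ?thesis using False by (simp add: coeff_eq_0)
  qed
qed

text \<open>This is \<open>\<omega>\<^sub>1\<close> as an alternating bilinear form, applied to the coefficient vectors of \<open>t\<^sup>j\<close> and \<open>t\<^sup>k\<close>.\<close>

definition bracket :: "complex poly ^ 4 \<Rightarrow> nat \<Rightarrow> nat \<Rightarrow> complex" where
  "bracket p j k =
     3 * (coeff (p $ 2) j * coeff (p $ 1) k - coeff (p $ 2) k * coeff (p $ 1) j)
     + (coeff (p $ 4) j * coeff (p $ 3) k - coeff (p $ 4) k * coeff (p $ 3) j)"

text \<open>The pair \<open>j < k\<close> contributes \<open>(k - j) * bracket p j k\<close> to the coefficient of \<open>t\<^sup>j\<^sup>+\<^sup>k\<^sup>-\<^sup>1\<close> in the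
  pullback of \<open>\<omega>\<^sub>1\<close>; for \<open>t\<^sup>2\<close> there are two such pairs.\<close>

definition tangent_cubic :: "complex poly ^ 4 \<Rightarrow> bool" where
  "tangent_cubic p \<longleftrightarrow> bracket p 0 1 = 0 \<and> bracket p 0 2 = 0
     \<and> 3 * bracket p 0 3 + bracket p 1 2 = 0 \<and> bracket p 1 3 = 0 \<and> bracket p 2 3 = 0"

lemma tangent_cubic_iff:
  assumes "\<And>i. degree (p $ i) \<le> 3"
  shows "omega1 p (\<chi> i. pderiv (p $ i)) = 0 \<longleftrightarrow> tangent_cubic p"
proof -
  have "omega1 p (\<chi> i. pderiv (p $ i)) =
    [:bracket p 0 1, 2 * bracket p 0 2, 3 * bracket p 0 3 + bracket p 1 2,
      2 * bracket p 1 3, bracket p 2 3:]"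
  proof -
    have *: "q * pderiv r - r * pderiv q =
      (let b = \<lambda>j k. coeff q j * coeff r k - coeff q k * coeff r j in
       [:b 0 1, 2 * b 0 2, 3 * b 0 3 + b 1 2, 2 * b 1 3, b 2 3:])"
      if dq: "degree q \<le> 3" and dr: "degree r \<le> 3" for q r :: "complex poly"
    proof -
      obtain q0 q1 q2 q3 r0 r1 r2 r3
        where "q = [:q0, q1, q2, q3:]" "r = [:r0, r1, r2, r3:]"
        by (rule that[OF cubic_poly_eq[OF dq] cubic_poly_eq[OF dr]])
      then show ?thesis
        by (simp add: Let_def pderiv_pCons algebra_simps eval_nat_numeral)
    qed
    have "omega1 p (\<chi> i. pderiv (p $ i)) =
      smult 3 (p $ 2 * pderiv (p $ 1) - p $ 1 * pderiv (p $ 2))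
      + (p $ 4 * pderiv (p $ 3) - p $ 3 * pderiv (p $ 4))"
      by (simp add: omega1_def algebra_simps smult_diff_right numeral_poly)
    then show ?thesis
      unfolding *[OF assms assms] by (simp add: Let_def bracket_def algebra_simps)
  qed
  then show ?thesis by (simp add: tangent_cubic_def)
qed

lemma omega1_reparametrize:
  assumes "tangent_cubic p"
  shows "omega1 (reparametrize u m p) (\<chi> i. pderiv (reparametrize u m p $ i)) = 0"
proof -
  define A where "A = [:m $ 1, u $ 1:]"
  define B where "B = [:m $ 2, u $ 2:]"
  define A' where "A' = [:u $ 1:]"
  define B' where "B' = [:u $ 2:]"
  define c where "c i k = [:coeff (p $ i) k:]" for i k
  define F where "F i = c i 0 * B^3 + c i 1 * (A * B^2) + c i 2 * (A^2 * B) + c i 3 * A^3" for i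
  define F' where "F' i = c i 0 * (3 * B^2 * B') + c i 1 * (A' * B^2 + A * (2 * B * B'))
     + c i 2 * (2 * A * A' * B + A^2 * B') + c i 3 * (3 * A^2 * A')" for i
  have F: "reparametrize u m p $ i = F i" for i
    by (simp add: reparametrize_def F_def A_def B_def c_def)
  have F': "pderiv (F i) = F' i" for i
  proof -
    have d: "pderiv A = A'" "pderiv B = B'" "pderiv (c i k) = 0" for k
      by (simp_all add: A_def B_def A'_def B'_def c_def pderiv_pCons)
    show ?thesis
      unfolding F_def F'_def
      by (simp add: pderiv_add pderiv_mult d eval_nat_numeral algebra_simps)
  qed
  define b where "b j k = 3 * (c 2 j * c 1 k - c 2 k * c 1 j)
     + (c 4 j * c 3 k - c 4 k * c 3 j)" for j k
  have b: "b j k = [:bracket p j k:]" for j k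
    by (simp add: b_def c_def bracket_def numeral_poly)
  have W: "F i * F' j - F j * F' i = (B * A' - A * B') *
      ((c i 0 * c j 1 - c i 1 * c j 0) * B^4 + 2 * (c i 0 * c j 2 - c i 2 * c j 0) * (A * B^3)
       + (3 * (c i 0 * c j 3 - c i 3 * c j 0) + (c i 1 * c j 2 - c i 2 * c j 1)) * (A^2 * B^2)
       + 2 * (c i 1 * c j 3 - c i 3 * c j 1) * (A^3 * B)
       + (c i 2 * c j 3 - c i 3 * c j 2) * A^4)" for i j
    unfolding F_def F'_def by (rule wronskian_cubic_form)
  have "omega1 (reparametrize u m p) (\<chi> i. pderiv (reparametrize u m p $ i))
      = 3 * (F 2 * F' 1 - F 1 * F' 2) + (F 4 * F' 3 - F 3 * F' 4)"
    by (simp add: omega1_def F F' algebra_simps)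
  also have "\<dots> = (B * A' - A * B') *
      (b 0 1 * B^4 + 2 * b 0 2 * (A * B^3) + (3 * b 0 3 + b 1 2) * (A^2 * B^2)
       + 2 * b 1 3 * (A^3 * B) + b 2 3 * A^4)"
    unfolding W b_def by (simp add: algebra_simps)
  also have "\<dots> = 0"
  proof -
    have "b 0 1 = 0" "b 0 2 = 0" "3 * b 0 3 + b 1 2 = 0" "b 1 3 = 0" "b 2 3 = 0"
      using assms by (simp_all add: b tangent_cubic_def numeral_poly mult.commute)
    then show ?thesis by simp
  qed
  finally show ?thesis .
qed

lemma cubic_parametrization_reparametrize:
  assumes "det2 u m \<noteq> 0" and "\<And>v. v \<noteq> 0 \<Longrightarrow> homogenize3 p v \<noteq> 0"
  shows "cubic_parametrization (reparametrize u m p) (range (curve_map p))"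
proof -
  define M where "M v = v $ 1 *s u + v $ 2 *s m" for v :: "complex^2"
  define N :: "complex^2 \<Rightarrow> complex^2" where
    "N w = vector [det2 w m / det2 u m, det2 u w / det2 u m]" for w
  have MN: "M (N w) = w" for w
    using assms(1)
    by (simp add: M_def N_def vec_eq_iff forall_2 divide_simps)
      (simp add: det2_def algebra_simps)
  have NM: "N (M v) = v" for v
    using assms(1)
    by (simp add: M_def N_def vec_eq_iff forall_2 divide_simps)
      (simp add: det2_def algebra_simps)
  have "M 0 = 0" "N 0 = 0"
    by (simp_all add: M_def N_def vec_eq_iff forall_2 det2_def)
  then have M0: "M v \<noteq> 0" and N0: "N v \<noteq> 0" if "v \<noteq> 0" for v
    using that MN NM by metis+
  have nz: "homogenize3 (reparametrize u m p) v \<noteq> 0" if "v \<noteq> 0" for v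
    using assms(2)[OF M0[OF that]] by (simp add: homogenize3_reparametrize M_def)
  have eq: "curve_map (reparametrize u m p) (abs_proj v) = curve_map p (abs_proj (M v))"
    if "v \<noteq> 0" for v
    using that nz assms(2) M0
    by (simp add: curve_map_abs_proj homogenize3_reparametrize M_def)
  have "curve_map (reparametrize u m p) q \<in> range (curve_map p)" for q
    using eq[OF rep_proj_nonzero[of q]] by (simp add: abs_proj_rep_proj)
  moreover have "curve_map p q \<in> range (curve_map (reparametrize u m p))" for q
    using eq[OF N0[OF rep_proj_nonzero[of q]]] by (simp add: abs_proj_rep_proj MN) (metis rangeI)
  ultimately have "range (curve_map (reparametrize u m p)) = range (curve_map p)" by blast
  with nz degree_reparametrize show ?thesis
    by (auto simp: cubic_parametrization_def)
qed

lemma cubic_parametrization_smult: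
  assumes "cubic_parametrization (\<chi> i. smult c (p $ i)) C" "c \<noteq> 0"
  shows "cubic_parametrization p C"
proof -
  have hom: "homogenize3 p v \<noteq> 0" if "v \<noteq> 0" for v
    using assms(1) that unfolding cubic_parametrization_def homogenize3_smult by auto
  have "curve_map (\<chi> i. smult c (p $ i)) q = curve_map p q" for q
    unfolding curve_map_def homogenize3_smult
    using hom[OF rep_proj_nonzero] assms(2) by (rule abs_proj_scale)
  with assms hom show ?thesis
    by (auto simp: cubic_parametrization_def cong: image_cong)
qed

section \<open>Tangent cubics in normalized position\<close>

text \<open>The proof compares coefficients. The two lowest tangency equations make \<open>z\<close> a
  monomial; this forces the scalars \<open>b\<close> and \<open>c\<close> at \<open>1\<close> and \<open>-1\<close> to be equal and makes the other three equations linear.\<close>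

lemma normalized_tangent_cubic:
  assumes deg: "\<And>i. degree (p $ i) \<le> 3" and tan: "tangent_cubic p"
    and "homogenize3 p (vector [0, 1]) = a *s vector [0, 0, 0, 1]" "a \<noteq> 0"
    and "homogenize3 p (vector [1, 1]) = b *s vector [1, 1, 1, 1]" "b \<noteq> 0"
    and "homogenize3 p (vector [-1, 1]) = c *s vector [-1, 1, -1, 1]"
  obtains \<mu> where "p = (\<chi> i. smult b (l_family \<mu> $ i))"
proof -
  obtain x0 x1 x2 x3 y0 y1 y2 y3 z0 z1 z2 z3 w0 w1 w2 w3
    where p: "p $ 1 = [:x0, x1, x2, x3:]" "p $ 2 = [:y0, y1, y2, y3:]"
      "p $ 3 = [:z0, z1, z2, z3:]" "p $ 4 = [:w0, w1, w2, w3:]"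
    by (rule that[OF cubic_poly_eq[OF deg] cubic_poly_eq[OF deg]
          cubic_poly_eq[OF deg] cubic_poly_eq[OF deg]])
  have at0: "x0 = 0" "y0 = 0" "z0 = 0" "w0 = a"
    using assms(3)
    by (simp_all add: vec_eq_iff forall_4 homogenize3_nth vector_4 p eval_nat_numeral)
  have at1: "x1 + x2 + x3 = b" "y1 + y2 + y3 = b" "z1 + z2 + z3 = b" "a + w1 + w2 + w3 = b"
    using assms(5) at0
    by (simp_all add: vec_eq_iff forall_4 homogenize3_nth vector_4 p eval_nat_numeral)
  have at2: "x1 - x2 + x3 = c" "- y1 + y2 - y3 = c" "z1 - z2 + z3 = c" "a - w1 + w2 - w3 = c"
    using assms(7) at0
    by (simp_all add: vec_eq_iff forall_4 homogenize3_nth vector_4 p eval_nat_numeral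
        algebra_simps)
  have tan': "a * z1 = 0" "a * z2 = 0"
      "3 * (a * z3) + (3 * (y1 * x2 - y2 * x1) + (w1 * z2 - w2 * z1)) = 0"
      "3 * (y1 * x3 - y3 * x1) + (w1 * z3 - w3 * z1) = 0"
      "3 * (y2 * x3 - y3 * x2) + (w2 * z3 - w3 * z2) = 0"
    using tan at0 unfolding tangent_cubic_def bracket_def
    by (simp_all add: p eval_nat_numeral)
  have z: "z1 = 0" "z2 = 0" "z3 = b" and cb: "c = b"
    using tan'(1,2) \<open>a \<noteq> 0\<close> at1(3) at2(3) by auto
  \<comment> \<open>The values at \<open>-1\<close> and \<open>1\<close> agree for \<open>y, w\<close> and are opposite for \<open>x\<close>. So the odd parts of
    \<open>y, w\<close> and the even part of \<open>x\<close> vanish at \<open>1\<close>, and the other parts have the value \<open>b\<close> there.\<close>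
  have parts: "q = 0 \<and> e = b" if "e + q = b" "e - q = b" for e q :: complex
  proof -
    have "2 * q = (e + q) - (e - q)" by simp
    also have "\<dots> = 0" using that by simp
    finally show ?thesis using that by simp
  qed
  have x: "x2 = 0" "x1 + x3 = b"
    using parts[of "x1 + x3" x2] at1(1) at2(1) cb by (simp_all add: algebra_simps)
  have y: "y1 + y3 = 0" "y2 = b"
    using parts[of y2 "y1 + y3"] at1(2) at2(2) cb by (simp_all add: algebra_simps)
  have w: "w1 + w3 = 0" "a + w2 = b"
    using parts[of "a + w2" "w1 + w3"] at1(4) at2(4) cb by (simp_all add: algebra_simps)
  have y1: "y1 = - y3" using y(1) by (rule eq_neg_iff_add_eq_0[THEN iffD2])
  have w3: "w3 = - w1" using w(1) by (rule minus_unique[symmetric])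
  have x3: "x3 = b - x1" using x(2) by auto
  have w2: "w2 = b - a" using w(2) by auto
  have "3 * (b * (a - x1)) = 0"
    by (rule trans[OF _ tan'(3)]) (simp add: z x(1) y(2) algebra_simps)
  then have x1: "x1 = a" using \<open>b \<noteq> 0\<close> by simp
  \<comment> \<open>Here \<open>w2 = x3 = b - a\<close>, whereas the coefficient of \<open>t\<^sup>4\<close> requires \<open>w2 = - 3 * x3\<close>.\<close>
  have "4 * (b * (b - a)) = 0"
    by (rule trans[OF _ tan'(5)]) (simp add: z x(1) x3 x1 y(2) w2 algebra_simps)
  then have ab: "a = b" using \<open>b \<noteq> 0\<close> by simp
  have "b * (w1 - 3 * y3) = 0"
    by (rule trans[OF _ tan'(4)]) (simp add: z x3 y1 algebra_simps)
  then have w1: "w1 = 3 * y3" using \<open>b \<noteq> 0\<close> by simp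
  have "\<forall>i. p $ i = smult b (l_family (- y3 / b) $ i)"
    using \<open>b \<noteq> 0\<close>
    by (simp add: forall_4 l_family_def vector_4 p at0 x1 x(1) x3 y1 y(2) z w1 w2 w3 ab)
  then show thesis using that[of "- y3 / b"] by (simp add: vec_eq_iff)
qed

section \<open>The cubics through the three points\<close>

text \<open>Proportional arguments have proportional images, because \<open>homogenize3 p\<close> is homogeneous.\<close>

lemma det2_nonzero_of_distinct_images:
  assumes "homogenize3 p u = r *s a" "homogenize3 p v = s *s b" "u \<noteq> 0" "s \<noteq> 0"
    and "\<And>k. b \<noteq> k *s a"
  shows "det2 u v \<noteq> 0"
proof
  assume "det2 u v = 0"
  then obtain k where "v = k *s u" using assms(3) by (rule det2_eq_0D)
  then have "s *s b = (k^3 * r) *s a"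
    using assms(1,2) by (simp add: homogenize3_scale)
  then have "b = (k^3 * r / s) *s a"
    using \<open>s \<noteq> 0\<close> by (simp add: vec_eq_iff field_simps)
  with assms(5) show False by blast
qed

theorem theorem6p2:
  fixes C :: "CP3 set"
  assumes "rational_cubic C"
    and "hpoint 0 0 0 1 \<in> C"
    and "hpoint 1 1 1 1 \<in> C"
    and "hpoint (-1) 1 (-1) 1 \<in> C"
    and "tangent_omega1 C"
  shows "\<exists>\<mu>::complex. cubic_parametrization (l_family \<mu>) C"
proof -
  let ?a = "vector [0, 0, 0, 1] :: complex^4"
  let ?b = "vector [1, 1, 1, 1] :: complex^4"
  let ?c = "vector [-1, 1, -1, 1] :: complex^4"
  from assms(5) obtain p where p: "cubic_parametrization p C"
    and "omega1 p (\<chi> i. pderiv (p $ i)) = 0"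
    by (auto simp: tangent_omega1_def)
  then have tan: "tangent_cubic p"
    using tangent_cubic_iff[of p] by (simp add: cubic_parametrization_def)
  have nz: "?a \<noteq> 0" "?b \<noteq> 0" "?c \<noteq> 0"
    by (simp_all add: vec_eq_iff forall_4 vector_4)
  obtain va ka where va: "va \<noteq> 0" "ka \<noteq> 0" "homogenize3 p va = ka *s ?a"
    using cubic_parametrization_hits[OF p assms(2)[unfolded hpoint_def] nz(1)] .
  obtain vb kb where vb: "vb \<noteq> 0" "kb \<noteq> 0" "homogenize3 p vb = kb *s ?b"
    using cubic_parametrization_hits[OF p assms(3)[unfolded hpoint_def] nz(2)] .
  obtain vc kc where vc: "vc \<noteq> 0" "kc \<noteq> 0" "homogenize3 p vc = kc *s ?c"
    using cubic_parametrization_hits[OF p assms(4)[unfolded hpoint_def] nz(3)] .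
  have ind: "?b \<noteq> k *s ?a" "?c \<noteq> k *s ?b" "?a \<noteq> k *s ?c" for k
    by (auto simp: vec_eq_iff forall_4 vector_4)
  have "det2 vb vc \<noteq> 0" "det2 vc va \<noteq> 0" "det2 va vb \<noteq> 0"
    using det2_nonzero_of_distinct_images[OF vb(3) vc(3) vb(1) vc(2) ind(2)]
      det2_nonzero_of_distinct_images[OF vc(3) va(3) vc(1) va(2) ind(3)]
      det2_nonzero_of_distinct_images[OF va(3) vb(3) va(1) vb(2) ind(1)] by auto
  then obtain u m r s k where um: "det2 u m \<noteq> 0" and rsk: "r \<noteq> 0" "s \<noteq> 0" "k \<noteq> 0"
    and frame: "m = r *s va" "u + m = s *s vb" "m - u = k *s vc"
    by (rule frame_through_three_lines)
  define q where "q = reparametrize u m p"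
  have q: "cubic_parametrization q C"
    using p cubic_parametrization_reparametrize[OF um] by (simp add: q_def cubic_parametrization_def)
  have "omega1 q (\<chi> i. pderiv (q $ i)) = 0"
    unfolding q_def using tan by (rule omega1_reparametrize)
  then have tan_q: "tangent_cubic q"
    using q tangent_cubic_iff[of q] by (simp add: cubic_parametrization_def)
  have hq: "homogenize3 q (vector [0, 1]) = homogenize3 p m"
    "homogenize3 q (vector [1, 1]) = homogenize3 p (u + m)"
    "homogenize3 q (vector [-1, 1]) = homogenize3 p (m - u)"
    by (simp_all add: q_def homogenize3_reparametrize)
  have "homogenize3 q (vector [0, 1]) = (r^3 * ka) *s ?a"
    "homogenize3 q (vector [1, 1]) = (s^3 * kb) *s ?b"
    "homogenize3 q (vector [-1, 1]) = (k^3 * kc) *s ?c"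
    unfolding hq frame(2,3) by (simp_all add: frame(1) homogenize3_scale va vb vc vector_smult_assoc)
  moreover have "degree (q $ i) \<le> 3" for i
    using q by (simp add: cubic_parametrization_def)
  moreover have "r^3 * ka \<noteq> 0" "s^3 * kb \<noteq> 0"
    using rsk va(2) vb(2) by simp_all
  ultimately obtain \<mu> where "q = (\<chi> i. smult (s^3 * kb) (l_family \<mu> $ i))"
    using normalized_tangent_cubic[OF _ tan_q] by metis
  with q \<open>s^3 * kb \<noteq> 0\<close> have "cubic_parametrization (l_family \<mu>) C"
    using cubic_parametrization_smult by blast
  then show ?thesis ..
qed

end
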